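(* Let $F$ be a finite field of cardinality $p^m$ ($p$ prime, $m\ge1$), let $q$ be a non-degenerate quadratic form over $F$ and let $a\in\widetilde{\mathsf D}(q)$. Then the girth $\mathsf g(\mathcal{G}_{q,a})$ is as follows. (i) If $a=0$: $\mathsf g=4$ if $F=\mathbb{F}_2$ and $q\in\{\mathbb{H},\mathbb{H}\perp[1,1]\}$ (up to isometry); otherwise $\mathsf g=3$. (ii) If $a\ne0$ and $\dim(q)=1$ (so $\mathrm{char}(F)\ne 2$): $\mathsf g=p$. (iii) If $a\ne 0$ and $\dim(q)=2$: $\mathsf g=\infty$ if $F=\mathbb{F}_2$ and $q\cong\mathbb{H}$; $\mathsf g=3$ if $F=\mathbb{F}_3$; $\mathsf g=3$ if $q\cong[a,a^{-1}]$; and $\mathsf g=4$ in all other cases. (iv) If $a\ne 0$ and $\dim(q)\ge 3$: $\mathsf g=3$.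
   Context: A quadratic form on a finite-dimensional $F$-vector space $V$ is a map $q:V\to F$ with $q(\lambda x)=\lambda^2q(x)$ such that $b_q(x,y)=q(x+y)-q(x)-q(y)$ is bilinear; non-degenerate means $\{x: b_q(x,y)=0\ \forall y\}=\{0\}$. $q$ is isotropic if $q(v)=0$ for some $v\ne0$. $\mathsf D(q)=\{q(v):v\in V\}\cap F^\ast$, and $\widetilde{\mathsf D}(q)=\mathsf D(q)\cup\{0\}$ if $q$ is isotropic, $\widetilde{\mathsf D}(q)=\mathsf D(q)$ otherwise. $[\alpha,\beta]$ denotes $(x,y)\mapsto\alpha x^2+xy+\beta y^2$, $\mathbb{H}=[0,0]$, $\perp$ is orthogonal sum. The representation graph $\mathcal{G}_{q,a}$ has vertex set $V$, with distinct $x,y$ adjacent iff $q(x-y)=a$. A cycle of length $n\ge 3$ is a sequence $(v_0,\dots,v_{n-1},v_0)$ of pairwise distinct vertices with consecutive ones adjacent; the girth is the minimum length of a cycle ($\infty$ if none).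
   Formalization: In (iii), "F = F_3" is replaced by "char(F) = 3", and "all other cases" then excludes characteristic 3; as stated it fails, e.g. for F = F_9, q = H, a = 1, where 0, v, -v with q(v) = 1 is a triangle. *)

theory Defs
  imports
    "HOL-Analysis.Product_Vector"
    "HOL-Library.Cardinality"
    "HOL-Library.Extended_Nat"
    "HOL-Computational_Algebra.Primes"
begin

text \<open>
  A vector space over the field \<open>'a\<close> is the whole type \<open>'v\<close> with a scalar multiplication
  \<open>s\<close>, as in \<^locale>\<open>vector_space\<close>; the base field itself is the space with scalar
  multiplication \<open>(*)\<close>, and products carry \<^const>\<open>module_prod.scale\<close>.
\<close>

definition polar :: "('v::ab_group_add \<Rightarrow> 'a::field) \<Rightarrow> 'v \<Rightarrow> 'v \<Rightarrow> 'a" where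
  "polar q x y = q (x + y) - q x - q y"

definition quadratic_form ::
    "('a::field \<Rightarrow> 'v::ab_group_add \<Rightarrow> 'v) \<Rightarrow> ('v \<Rightarrow> 'a) \<Rightarrow> bool" where
  "quadratic_form s q \<longleftrightarrow>
     (\<forall>c x. q (s c x) = c\<^sup>2 * q x) \<and>
     (\<forall>y. Vector_Spaces.linear s (*) (\<lambda>x. polar q x y)) \<and>
     (\<forall>x. Vector_Spaces.linear s (*) (\<lambda>y. polar q x y))"

definition nondegenerate :: "('v::ab_group_add \<Rightarrow> 'a::field) \<Rightarrow> bool" where
  "nondegenerate q \<longleftrightarrow> {x. \<forall>y. polar q x y = 0} = {0}"

definition isotropic :: "('v::ab_group_add \<Rightarrow> 'a::field) \<Rightarrow> bool" where
  "isotropic q \<longleftrightarrow> (\<exists>v. v \<noteq> 0 \<and> q v = 0)"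

definition represented :: "('v::ab_group_add \<Rightarrow> 'a::field) \<Rightarrow> 'a set" where
  "represented q = range q - {0}"

text \<open>The set \<open>\<D>\<close> with a tilde: zero is added only if it is represented nontrivially.\<close>

definition represented0 :: "('v::ab_group_add \<Rightarrow> 'a::field) \<Rightarrow> 'a set" where
  "represented0 q = (if isotropic q then represented q \<union> {0} else represented q)"

definition isometric ::
    "('a::field \<Rightarrow> 'v::ab_group_add \<Rightarrow> 'v) \<Rightarrow> ('v \<Rightarrow> 'a) \<Rightarrow>
     ('a \<Rightarrow> 'w::ab_group_add \<Rightarrow> 'w) \<Rightarrow> ('w \<Rightarrow> 'a) \<Rightarrow> bool" where
  "isometric s q s' q' \<longleftrightarrow>
     (\<exists>f. Vector_Spaces.linear s s' f \<and> bij f \<and> (\<forall>x. q' (f x) = q x))"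

abbreviation plane_scale :: "'a::field \<Rightarrow> 'a \<times> 'a \<Rightarrow> 'a \<times> 'a" where
  "plane_scale \<equiv> module_prod.scale (*) (*)"

definition binary_form :: "'a::field \<Rightarrow> 'a \<Rightarrow> 'a \<times> 'a \<Rightarrow> 'a" where
  "binary_form \<alpha> \<beta> = (\<lambda>(x, y). \<alpha> * x\<^sup>2 + x * y + \<beta> * y\<^sup>2)"

definition hyperbolic_plane :: "'a::field \<times> 'a \<Rightarrow> 'a" where
  "hyperbolic_plane = binary_form 0 0"

definition orthogonal_sum ::
    "('v \<Rightarrow> 'a::field) \<Rightarrow> ('w \<Rightarrow> 'a) \<Rightarrow> 'v \<times> 'w \<Rightarrow> 'a" where
  "orthogonal_sum q q' = (\<lambda>(x, y). q x + q' y)"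

text \<open>
  A graph with vertex set the whole type is given by its adjacency relation \<open>E\<close>. The list \<open>vs\<close>
  enumerates a cycle without repeating the initial vertex at the end.
\<close>

definition representation_graph ::
    "('v::ab_group_add \<Rightarrow> 'a::field) \<Rightarrow> 'a \<Rightarrow> 'v \<Rightarrow> 'v \<Rightarrow> bool" where
  "representation_graph q a x y \<longleftrightarrow> x \<noteq> y \<and> q (x - y) = a"

definition is_cycle :: "('v \<Rightarrow> 'v \<Rightarrow> bool) \<Rightarrow> 'v list \<Rightarrow> bool" where
  "is_cycle E vs \<longleftrightarrow> length vs \<ge> 3 \<and> distinct vs \<and>
     (\<forall>i < length vs. E (vs ! i) (vs ! (Suc i mod length vs)))"

text \<open>In \<^typ>\<open>enat\<close> the infimum of the empty set is \<open>\<infinity>\<close>.\<close>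

definition girth :: "('v \<Rightarrow> 'v \<Rightarrow> bool) \<Rightarrow> enat" where
  "girth E = (INF vs \<in> {vs. is_cycle E vs}. enat (length vs))"

end

theory Submission
  imports Defs
begin

text \<open>
  By translation, a triangle amounts to two vectors \<open>v\<close>, \<open>w\<close> with \<open>q v = q w = q (v - w) = a\<close>,
  that is \<open>q v = q w = polar q v w = a\<close> when \<open>a \<noteq> 0\<close>, and any \<open>v \<noteq> \<plusminus>w\<close> of value \<open>a\<close> give the
  4-cycle \<open>0, v, v + w, w\<close>. In dimension at least 3 a suitable \<open>w\<close> is found as \<open>v/2 + z\<close> with \<open>z\<close>
  orthogonal to \<open>v\<close> and \<open>q z = 3a/4\<close>, using universality of binary forms, or in characteristic 2
  as \<open>w\<^sub>0 + cz\<close> with \<open>z\<close> orthogonal to \<open>v\<close> and \<open>w\<^sub>0\<close>, using surjectivity of the Frobenius map. In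
  dimension 2 and characteristic other than 3, the pair \<open>v\<close>, \<open>w/a\<close> of a triangle is a basis
  exhibiting \<open>q\<close> as \<open>[a, 1/a]\<close>; a 4-cycle arises from a reflection or from a hyperbolic pair.
\<close>

section \<open>Recognising girth 3 and 4 from an explicit short cycle\<close>

lemma girth_eq_3:
  assumes irrefl: "\<And>x. \<not> E x x" and edges: "E x y" "E y z" "E z x"
  shows "girth E = 3"
  unfolding girth_def
proof (rule antisym)
  have "distinct [x, y, z]"
    using irrefl edges by auto
  then have "is_cycle E [x, y, z]"
    using edges by (auto simp: is_cycle_def less_Suc_eq)
  from INF_lower2[of "[x, y, z]" "{vs. is_cycle E vs}" "\<lambda>vs. enat (length vs)" 3] this
  show "(INF vs\<in>{vs. is_cycle E vs}. enat (length vs)) \<le> 3"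
    by (simp add: numeral_eq_enat)
  show "3 \<le> (INF vs\<in>{vs. is_cycle E vs}. enat (length vs))"
    by (rule INF_greatest) (auto simp: is_cycle_def numeral_eq_enat)
qed

text \<open>Irreflexivity already separates adjacent vertices, so inequalities are demanded only for
  the two diagonals. A cycle of length 3 would be an excluded triangle.\<close>

lemma girth_eq_4:
  assumes irrefl: "\<And>x. \<not> E x x" and edges: "E x y" "E y z" "E z w" "E w x" "x \<noteq> z" "y \<noteq> w"
    and no_triangle: "\<And>x y z. E x y \<Longrightarrow> E y z \<Longrightarrow> E z x \<Longrightarrow> False"
  shows "girth E = 4"
  unfolding girth_def
proof (rule antisym)
  have "distinct [x, y, z, w]"
    using irrefl edges by auto
  then have "is_cycle E [x, y, z, w]"
    using edges by (auto simp: is_cycle_def less_Suc_eq)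
  from INF_lower2[of "[x, y, z, w]" "{vs. is_cycle E vs}" "\<lambda>vs. enat (length vs)" 4] this
  show "(INF vs\<in>{vs. is_cycle E vs}. enat (length vs)) \<le> 4"
    by (simp add: numeral_eq_enat)
  show "4 \<le> (INF vs\<in>{vs. is_cycle E vs}. enat (length vs))"
  proof (rule INF_greatest)
    fix vs assume "vs \<in> {vs. is_cycle E vs}"
    then have len: "length vs \<ge> 3"
      and adj: "\<And>i. i < length vs \<Longrightarrow> E (vs ! i) (vs ! (Suc i mod length vs))"
      by (auto simp: is_cycle_def)
    have "length vs \<noteq> 3"
      using adj[of 0] adj[of 1] adj[of 2] no_triangle[of "vs ! 0" "vs ! 1" "vs ! 2"]
      by (auto simp: numeral_2_eq_2 simp flip: length_greater_0_conv)
    with len show "4 \<le> enat (length vs)"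
      by (simp add: numeral_eq_enat)
  qed
qed

section \<open>Finite fields: squares and characteristic\<close>

text \<open>Pigeonhole: more than half of the field elements are squares, so the sets of all
  \<alpha>s and of all c - \<beta>s, for s a square, must meet.\<close>

lemma diagonal_form_universal:
  fixes \<alpha> \<beta> c :: "'a::{field,finite}"
  assumes "\<alpha> \<noteq> 0" "\<beta> \<noteq> 0"
  obtains x y where "\<alpha> * x\<^sup>2 + \<beta> * y\<^sup>2 = c"
proof -
  define S where "S = range (\<lambda>x::'a. x\<^sup>2)"
  define g where "g = (\<lambda>s::'a. SOME x. x\<^sup>2 = s)"
  have g: "(g (x\<^sup>2))\<^sup>2 = x\<^sup>2" for x
    unfolding g_def by (rule someI[of _ x]) simp
  \<comment> \<open>Every x is one of the two chosen roots of its square, and 0 needs only one of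
    them. Counting gives at most 2|S| - 1 field elements.\<close>
  have "x \<in> g ` S \<union> (\<lambda>s. - g s) ` (S - {0})" for x
  proof -
    have "x = g (x\<^sup>2) \<or> x = - g (x\<^sup>2)"
      using g[of x] by (metis power2_eq_iff)
    moreover have "x\<^sup>2 \<in> S"
      by (simp add: S_def)
    moreover have "x = g (x\<^sup>2)" if "x\<^sup>2 = 0"
      using that g[of x] by simp
    ultimately show ?thesis
      by blast
  qed
  then have "UNIV \<subseteq> g ` S \<union> (\<lambda>s. - g s) ` (S - {0})"
    by blast
  then have "CARD('a) \<le> card (g ` S \<union> (\<lambda>s. - g s) ` (S - {0}))"
    by (rule card_mono[rotated]) simp
  also have "\<dots> \<le> card (g ` S) + card ((\<lambda>s. - g s) ` (S - {0}))"
    by (rule card_Un_le)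
  also have "\<dots> \<le> card S + card (S - {0})"
    by (intro add_mono card_image_le) simp_all
  also have "card (S - {0}) < card S"
  proof (rule psubset_card_mono)
    have "0 \<in> S"
      unfolding S_def by (rule range_eqI[of _ _ 0]) simp
    then show "S - {0} \<subset> S"
      by blast
  qed simp
  finally have less: "CARD('a) < card S + card S"
    by simp
  have "(\<lambda>s. \<alpha> * s) ` S \<inter> (\<lambda>s. c - \<beta> * s) ` S \<noteq> {}"
  proof
    assume "(\<lambda>s. \<alpha> * s) ` S \<inter> (\<lambda>s. c - \<beta> * s) ` S = {}"
    then have "card ((\<lambda>s. \<alpha> * s) ` S \<union> (\<lambda>s. c - \<beta> * s) ` S)
        = card ((\<lambda>s. \<alpha> * s) ` S) + card ((\<lambda>s. c - \<beta> * s) ` S)"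
      by (rule card_Un_disjoint[rotated -1]) simp_all
    also have "card ((\<lambda>s. \<alpha> * s) ` S) = card S"
      using assms by (intro card_image inj_onI) simp
    also have "card ((\<lambda>s. c - \<beta> * s) ` S) = card S"
      using assms by (intro card_image inj_onI) simp
    finally show False
      using less card_mono[of UNIV "(\<lambda>s. \<alpha> * s) ` S \<union> (\<lambda>s. c - \<beta> * s) ` S"] by simp
  qed
  then obtain x y where "\<alpha> * x\<^sup>2 = c - \<beta> * y\<^sup>2"
    unfolding S_def by blast
  then have "\<alpha> * x\<^sup>2 + \<beta> * y\<^sup>2 = c"
    by simp
  then show ?thesis
    by (rule that)
qed

text \<open>In characteristic 2 the Frobenius map is additive with trivial kernel; an injective
  self-map of a finite set is onto.\<close>

lemma square_surj_char_2:
  assumes "(2::'a::{field,finite}) = 0"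
  shows "surj (\<lambda>x::'a. x\<^sup>2)"
proof (rule finite_UNIV_inj_surj)
  show "inj (\<lambda>x::'a. x\<^sup>2)"
  proof (rule injI)
    fix x y :: 'a assume "x\<^sup>2 = y\<^sup>2"
    then have "(x - y)\<^sup>2 = 2 * (y\<^sup>2 - x * y)"
      by (simp add: power2_eq_square algebra_simps)
    with assms show "x = y"
      by simp
  qed
qed simp

text \<open>Translation by 1 permutes the field, so comparing the sums of all elements shows that
  the cardinality vanishes in the field. The prime characteristic then divides a power of p.\<close>

lemma CHAR_eq_if_CARD_eq_prime_power:
  assumes "prime p" "CARD('a::{field,finite}) = p ^ m"
  shows "CHAR('a) = p"
proof -
  have "(\<Sum>x\<in>UNIV. x + 1) = (\<Sum>x\<in>UNIV. x::'a)"
    by (rule sum.reindex_bij_witness[of _ "\<lambda>x. x - 1" "\<lambda>x. x + 1"]) auto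
  then have "of_nat CARD('a) = (0::'a)"
    by (simp add: sum.distrib)
  then have "CHAR('a) dvd p ^ m"
    using assms(2) of_nat_eq_0_iff_char_dvd[where ?'a = 'a, of "CARD('a)"] by metis
  moreover have "prime CHAR('a)"
    by (rule prime_CHAR_semidom) (simp add: finite_imp_CHAR_pos)
  ultimately show ?thesis
    using assms(1) prime_dvd_power primes_dvd_imp_eq by blast
qed

text \<open>A choice of basis gives a map out of the model space, whereas \<open>isometric\<close>
  asks for a map into it; the inverse mediates.\<close>

lemma isometric_by_parametrization:
  assumes "Vector_Spaces.linear s' s g" "bij g" "\<And>x. q (g x) = q' x"
  shows "isometric s q s' q'"
  unfolding isometric_def
proof (intro exI conjI allI)
  interpret Vector_Spaces.linear s' s g by fact
  interpret module_pair s' s ..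
  show "Vector_Spaces.linear s s' (inv g)"
    unfolding linear_iff_module_hom
    by (rule bij_module_hom_imp_inv_module_hom[OF module_hom_axioms assms(2)])
  show "bij (inv g)"
    using assms(2) by (rule bij_imp_bij_inv)
  show "q' (inv g x) = q x" for x
    using assms(3)[of "inv g x"] assms(2) by (simp add: bij_is_surj surj_f_inv_f)
qed

interpretation plane: vector_space_prod "(*) :: 'a::field \<Rightarrow> _" "(*) :: 'a \<Rightarrow> _"
  by unfold_locales (simp_all add: algebra_simps)

interpretation plane_sum: vector_space_prod "plane_scale :: 'a::field \<Rightarrow> _" "plane_scale :: 'a \<Rightarrow> _"
  by unfold_locales

section \<open>Nondegenerate quadratic spaces: polar form, orthogonal complements, hyperbolic
  pairs\<close>

locale quadratic_space = vector_space scale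
  for scale :: "'a::field \<Rightarrow> 'v::ab_group_add \<Rightarrow> 'v" (infixr \<open>*s\<close> 75) +
  fixes q :: "'v \<Rightarrow> 'a"
  assumes quadratic_form: "quadratic_form scale q"
    and nondegenerate: "nondegenerate q"
begin

lemma form_scale: "q (c *s x) = c\<^sup>2 * q x"
  using quadratic_form by (simp add: quadratic_form_def)

lemma form_add: "q (x + y) = q x + q y + polar q x y"
  by (simp add: polar_def)

lemma polar_commute: "polar q x y = polar q y x"
  by (simp add: polar_def add.commute)

lemma polar_add_left: "polar q (x + y) z = polar q x z + polar q y z"
  and polar_scale_left: "polar q (c *s x) z = c * polar q x z"
proof -
  have "Vector_Spaces.linear scale (*) (\<lambda>x. polar q x z)"
    using quadratic_form unfolding quadratic_form_def by blast
  then interpret l: Vector_Spaces.linear scale "(*)" "\<lambda>x. polar q x z" .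
  show "polar q (x + y) z = polar q x z + polar q y z" "polar q (c *s x) z = c * polar q x z"
    using l.add l.scale by simp_all
qed

lemma polar_add_right: "polar q z (x + y) = polar q z x + polar q z y"
  and polar_scale_right: "polar q z (c *s x) = c * polar q z x"
  by (metis polar_commute polar_add_left) (metis polar_commute polar_scale_left)

lemma form_zero: "q 0 = 0"
  using form_scale[of 0 0] by simp

lemma form_minus: "q (- x) = q x"
  using form_scale[of "-1" x] by simp

lemma polar_zero_left: "polar q 0 x = 0" and polar_zero_right: "polar q x 0 = 0"
  by (simp_all add: polar_def form_zero)

lemma polar_minus_left: "polar q (- x) y = - polar q x y"
  using polar_scale_left[of "-1" x y] by simp

lemma polar_minus_right: "polar q x (- y) = - polar q x y"
  using polar_minus_left polar_commute by metis

lemma polar_diff_left: "polar q (x - y) z = polar q x z - polar q y z"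
  using polar_add_left[of x "- y"] by (simp add: polar_minus_left)

lemma polar_diff_right: "polar q z (x - y) = polar q z x - polar q z y"
  using polar_add_right[of z x "- y"] by (simp add: polar_minus_right)

lemma polar_self: "polar q x x = 2 * q x"
proof -
  have "x + x = 2 *s x"
    using scale_left_distrib[of 1 1 x] by simp
  then show ?thesis
    by (simp add: polar_def form_scale power2_eq_square)
qed

lemma form_diff: "q (x - y) = q x + q y - polar q x y"
  using form_add[of x "- y"] by (simp add: form_minus polar_minus_right)

lemmas polar_simps = polar_add_left polar_add_right polar_scale_left polar_scale_right
  polar_diff_left polar_diff_right polar_minus_left polar_minus_right
  polar_zero_left polar_zero_right polar_self

lemma eq_zero_if_orthogonal: "(\<And>y. polar q x y = 0) \<Longrightarrow> x = 0"
  using nondegenerate by (auto simp: nondegenerate_def)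

lemma obtain_polar:
  assumes "x \<noteq> 0"
  obtains y where "polar q x y = c"
proof -
  obtain y where "polar q x y \<noteq> 0"
    using assms eq_zero_if_orthogonal by blast
  then have "polar q x ((c / polar q x y) *s y) = c"
    by (simp add: polar_simps)
  then show ?thesis
    by (rule that)
qed

lemma orthogonal_span:
  assumes "p \<in> span S" "\<And>p. p \<in> S \<Longrightarrow> polar q z p = 0"
  shows "polar q z p = 0"
  using assms by (induction rule: span_induct_alt) (auto simp: polar_simps)

text \<open>
  If \<open>q\<close> vanished on the orthogonal complement of \<open>S\<close>, so would its polar form, and the
  complement would lie in the radical.
\<close>

lemma obtain_nonsingular_orthogonal:
  assumes proj: "\<And>x. \<exists>y\<in>span S. \<forall>p\<in>S. polar q (x - y) p = 0" and "span S \<noteq> UNIV"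
  obtains z where "\<forall>p\<in>S. polar q z p = 0" "q z \<noteq> 0"
proof -
  have "\<exists>z. (\<forall>p\<in>S. polar q z p = 0) \<and> q z \<noteq> 0"
  proof (rule ccontr)
    assume "\<not> ?thesis"
    then have sing: "q z = 0" if "\<forall>p\<in>S. polar q z p = 0" for z
      using that by blast
    obtain x where "x \<notin> span S"
      using assms(2) by blast
    obtain y where y: "y \<in> span S" "\<forall>p\<in>S. polar q (x - y) p = 0"
      using proj by blast
    define z where "z = x - y"
    have z: "\<forall>p\<in>S. polar q z p = 0" and "z \<noteq> 0"
      using y \<open>x \<notin> span S\<close> by (auto simp: z_def)
    have "polar q z w = 0" for w
    proof -
      obtain y' where y': "y' \<in> span S" "\<forall>p\<in>S. polar q (w - y') p = 0"
        using proj by blast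
      \<comment> \<open>\<open>z\<close>, \<open>w - y'\<close> and their sum all lie in the
        complement, so all three have value 0 and polarization leaves nothing.\<close>
      have "polar q z (w - y') = 0"
        using form_add[of z "w - y'"] sing[of "z + (w - y')"] sing[of z] sing[of "w - y'"] z y'
        by (simp add: polar_simps)
      moreover have "polar q z y' = 0"
        using orthogonal_span[OF y'(1)] z by blast
      ultimately show ?thesis
        by (simp add: polar_simps)
    qed
    with \<open>z \<noteq> 0\<close> show False
      using eq_zero_if_orthogonal by blast
  qed
  then show ?thesis
    using that by blast
qed

text \<open>Since \<open>v\<close> is orthogonal to itself, moving \<open>w\<close> along
  \<open>v\<close> keeps the pairing with \<open>v\<close> and changes \<open>q w\<close> linearly,
  so a suitable multiple of \<open>v\<close> removes the value.\<close>

lemma obtain_hyperbolic_pair: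
  assumes "v \<noteq> 0" "q v = 0"
  obtains w where "q w = 0" "polar q v w = 1"
proof -
  obtain w where w: "polar q v w = 1"
    using assms(1) by (rule obtain_polar)
  have "polar q w v = 1"
    using w polar_commute by metis
  then have "q (w - q w *s v) = 0" "polar q v (w - q w *s v) = 1"
    using assms(2) w by (simp_all add: form_diff form_scale polar_simps)
  then show ?thesis
    by (rule that)
qed

section \<open>Short cycles of the representation graph in terms of vectors\<close>

lemma irreflexive_representation_graph: "\<not> representation_graph q a x x"
  by (simp add: representation_graph_def)

lemma girth_eq_3_if_triangle:
  assumes "v \<noteq> 0" "w \<noteq> 0" "v \<noteq> w" "q v = a" "q w = a" "q (v - w) = a"
  shows "girth (representation_graph q a) = 3"
  by (rule girth_eq_3[where x = 0 and y = v and z = w])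
    (use assms in \<open>auto simp: representation_graph_def form_minus\<close>)

text \<open>Here q (v - w) = 2a - a. As 0 has value 0, a nonzero \<open>a\<close> makes the three
  corners distinct.\<close>

lemma girth_eq_3_if_polar:
  assumes "a \<noteq> 0" "q v = a" "q w = a" "polar q v w = a"
  shows "girth (representation_graph q a) = 3"
proof -
  have "q (v - w) = a"
    using assms by (simp add: form_diff)
  moreover have "v \<noteq> 0" "w \<noteq> 0"
    using assms(1-3) form_zero by blast+
  moreover have "v \<noteq> w"
    using \<open>q (v - w) = a\<close> assms(1) form_zero right_minus_eq by metis
  ultimately show ?thesis
    using assms(2,3) by (intro girth_eq_3_if_triangle[of v w])
qed

text \<open>The parallelogram spanned by \<open>v\<close> and \<open>w\<close> has diagonals v + w
  and v - w, which is why \<open>w\<close> must differ from both \<open>v\<close> and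
  \<open>- v\<close>.\<close>

lemma girth_eq_4_if_square:
  assumes "v \<noteq> 0" "w \<noteq> 0" "v \<noteq> w" "v \<noteq> - w" "q v = a" "q w = a"
    and no_triangle: "\<And>v w. v \<noteq> 0 \<Longrightarrow> w \<noteq> 0 \<Longrightarrow> v \<noteq> w \<Longrightarrow>
      q v = a \<Longrightarrow> q w = a \<Longrightarrow> q (v - w) = a \<Longrightarrow> False"
  shows "girth (representation_graph q a) = 4"
proof -
  have "v + w \<noteq> 0"
    using assms(4) eq_neg_iff_add_eq_0 by blast
  show ?thesis
  proof (rule girth_eq_4[where x = 0 and y = v and z = "v + w" and w = w])
    show "\<not> representation_graph q a x x" for x
      by (rule irreflexive_representation_graph)
    \<comment> \<open>Translating z to the origin turns a triangle into the vectors
      \<open>x - z\<close> and \<open>y - z\<close>.\<close>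
    show "False" if "representation_graph q a x y" "representation_graph q a y z"
        "representation_graph q a z x" for x y z
      using that no_triangle[of "x - z" "y - z"] form_minus[of "x - z"]
      by (auto simp: representation_graph_def)
  qed (use assms(1-6) \<open>v + w \<noteq> 0\<close> in \<open>auto simp: representation_graph_def form_minus\<close>)
qed

text \<open>As q (- x) = q x, a unique vector of value \<open>a\<close> equals its own negative.
  Every vertex then has at most one neighbour, and a second step leads back to the start.\<close>

lemma girth_infinite_if_unique:
  assumes "\<And>x y. q x = a \<Longrightarrow> q y = a \<Longrightarrow> x = y"
  shows "girth (representation_graph q a) = \<infinity>"
proof -
  have False if "is_cycle (representation_graph q a) vs" for vs
  proof -
    have len: "length vs \<ge> 3" and "distinct vs"
      and adj: "\<And>i. i < length vs \<Longrightarrow> q (vs ! i - vs ! (Suc i mod length vs)) = a"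
      using that by (auto simp: is_cycle_def representation_graph_def)
    have "q (vs ! 0 - vs ! 1) = a" "q (vs ! 1 - vs ! 2) = a"
      using adj[of 0] adj[of 1] len by (auto simp: numeral_2_eq_2 simp flip: length_greater_0_conv)
    then have "vs ! 0 - vs ! 1 = - (vs ! 1 - vs ! 2)"
      by (intro assms) (simp_all only: form_minus)
    then have "vs ! 0 = vs ! 2"
      by simp
    then show False
      using \<open>distinct vs\<close> len nth_eq_iff_index_eq[of vs 0 2] by linarith
  qed
  then have "{vs. is_cycle (representation_graph q a) vs} = {}"
    by blast
  then show ?thesis
    by (simp add: girth_def top_enat_def)
qed

end

section \<open>Coordinates, and isotropic spaces over F_2 without a totally singular plane\<close>

lemma UNIV_eq_0_1_if_CARD_2:
  assumes "CARD('a::{field,finite}) = 2"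
  shows "UNIV = {0, 1::'a}"
  by (rule sym, rule card_subset_eq) (simp_all add: assms)

lemma two_eq_zero_if_CARD_2:
  assumes "CARD('a::{field,finite}) = 2"
  shows "(2::'a) = 0"
proof -
  have "CHAR('a) = 2"
    by (rule CHAR_eq_if_CARD_eq_prime_power[of 2 1]) (simp_all add: assms)
  then show ?thesis
    using of_nat_CHAR[where ?'a = 'a] by simp
qed

context quadratic_space
begin

lemma linear_plane: "Vector_Spaces.linear plane_scale scale (\<lambda>(x, y). x *s v + y *s w)"
  by unfold_locales (auto simp: plane.scale_prod algebra_simps)

lemma isometric_plane:
  assumes "polar q v w = 1" "bij (\<lambda>(x, y). x *s v + y *s w)"
  shows "isometric scale q plane_scale (binary_form (q v) (q w))"
  using linear_plane assms(2)
  by (rule isometric_by_parametrization)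
    (auto simp: form_add form_scale polar_simps assms(1) binary_form_def algebra_simps)

lemma linear_plane_sum:
  "Vector_Spaces.linear (module_prod.scale plane_scale plane_scale) scale
    (\<lambda>((x, y), (z, t)). x *s v + y *s w + (z *s u + t *s u'))"
  by unfold_locales (auto simp: plane.scale_prod plane_sum.scale_prod algebra_simps)

text \<open>
  Without a totally singular plane, the complement of a hyperbolic plane is anisotropic. Over
  \<open>\<F>\<^sub>2\<close> it has dimension at most 2, because two orthogonal nonzero vectors both have value 1 and
  hence a singular sum.
\<close>

lemma isometric_if_no_isotropic_plane:
  assumes field: "\<And>c::'a. c = 0 \<or> c = 1" and two: "(2::'a) = 0"
    and "isotropic q"
    and no_triangle: "\<And>v w. v \<noteq> 0 \<Longrightarrow> w \<noteq> 0 \<Longrightarrow> v \<noteq> w \<Longrightarrow>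
      q v = 0 \<Longrightarrow> q w = 0 \<Longrightarrow> q (v - w) = 0 \<Longrightarrow> False"
  shows "isometric scale q plane_scale hyperbolic_plane \<or>
    isometric scale q (module_prod.scale plane_scale plane_scale)
      (orthogonal_sum hyperbolic_plane (binary_form 1 1))"
proof -
  obtain e where e: "e \<noteq> 0" "q e = 0"
    using assms(3) by (auto simp: isotropic_def)
  then obtain f where f: "q f = 0" "polar q e f = 1"
    by (rule obtain_hyperbolic_pair)
  then have fe: "polar q f e = 1"
    using polar_commute by metis
  note hyp = e(2) f fe
  \<comment> \<open>In a hyperbolic pair each vector is dual to the other, so the coefficient of
    \<open>e\<close> is the pairing with \<open>f\<close> and conversely.\<close>
  have proj: "\<exists>y\<in>span {e, f}. \<forall>p\<in>{e, f}. polar q (x - y) p = 0" for x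
  proof
    show "polar q x f *s e + polar q x e *s f \<in> span {e, f}"
      by (intro span_add span_scale span_base) simp_all
    show "\<forall>p\<in>{e, f}. polar q (x - (polar q x f *s e + polar q x e *s f)) p = 0"
      using hyp by (simp add: polar_simps)
  qed
  show ?thesis
  proof (cases "span {e, f} = UNIV")
    case True
    have "inj (\<lambda>(x, y). x *s e + y *s f)"
      by (rule inj_on_inverseI[where g = "\<lambda>x. (polar q x f, polar q x e)"])
        (use hyp in \<open>auto simp: polar_simps\<close>)
    moreover have "surj (\<lambda>(x, y). x *s e + y *s f)"
    proof (rule surjI[of _ "\<lambda>x. (polar q x f, polar q x e)"])
      fix x
      define r where "r = x - (polar q x f *s e + polar q x e *s f)"
      have "polar q r e = 0" "polar q r f = 0"
        using hyp by (simp_all add: r_def polar_simps)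
      then have "polar q r y = 0" for y
        using orthogonal_span[of y "{e, f}" r] True by auto
      then have "r = 0"
        by (rule eq_zero_if_orthogonal)
      then show "(case (polar q x f, polar q x e) of (x, y) \<Rightarrow> x *s e + y *s f) = x"
        by (simp add: r_def)
    qed
    ultimately have "isometric scale q plane_scale (binary_form (q e) (q f))"
      using hyp by (intro isometric_plane bijI)
    then show ?thesis
      using hyp by (simp add: hyperbolic_plane_def)
  next
    case False
    \<comment> \<open>A singular \<open>z\<close> orthogonal to \<open>e\<close> would span a
      totally singular plane with it, giving the triangle 0, e, z; \<open>z\<close> is not
      \<open>e\<close>, because only \<open>e\<close> pairs nontrivially with
      \<open>f\<close>.\<close>
    have form_1: "q z = 1" if "z \<noteq> 0" "polar q z e = 0" "polar q z f = 0" for z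
    proof (rule ccontr)
      assume "q z \<noteq> 1"
      then have "q z = 0"
        using field by blast
      moreover have "polar q e z = 0"
        using that polar_commute by metis
      moreover have "e \<noteq> z"
        using that hyp by auto
      ultimately show False
        using no_triangle[of e z] e that(1) by (simp add: form_diff)
    qed
    obtain u where u: "polar q u e = 0" "polar q u f = 0" "q u \<noteq> 0"
      using obtain_nonsingular_orthogonal[OF proj False] by auto
    then have "u \<noteq> 0"
      by (auto simp: form_zero)
    then obtain y where y: "polar q u y = 1"
      by (rule obtain_polar)
    \<comment> \<open>Removing the component of \<open>y\<close> in the hyperbolic plane keeps its
      pairing with \<open>u\<close>. Then \<open>u\<close> and \<open>u'\<close> have value 1 and
      pairing 1, which is the form [1,1].\<close>
    define u' where "u' = y - (polar q y f *s e + polar q y e *s f)"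
    have u': "polar q u' e = 0" "polar q u' f = 0" "polar q u u' = 1"
      using hyp u y by (simp_all add: u'_def polar_simps)
    then have "u' \<noteq> 0"
      by (auto simp: polar_simps)
    have qu: "q u = 1" "q u' = 1"
      using form_1 u u' \<open>u \<noteq> 0\<close> \<open>u' \<noteq> 0\<close> by blast+
    have comm: "polar q e u = 0" "polar q f u = 0" "polar q e u' = 0" "polar q f u' = 0"
        "polar q u' u = 1"
      using u u' polar_commute by metis+
    note basis = hyp u(1,2) u' qu comm two
    let ?g = "\<lambda>((x, y), (z, t)). x *s e + y *s f + (z *s u + t *s u')"
    \<comment> \<open>The coordinates are again swapped pairings: \<open>u\<close> and
      \<open>u'\<close> are orthogonal to themselves because 2 = 0.\<close>
    have "inj ?g"
      by (rule inj_on_inverseI[where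
            g = "\<lambda>x. ((polar q x f, polar q x e), (polar q x u', polar q x u))"])
        (use basis in \<open>auto simp: polar_simps\<close>)
    moreover have "surj ?g"
    proof (rule surjI[of _ "\<lambda>x. ((polar q x f, polar q x e), (polar q x u', polar q x u))"])
      fix x
      define r where "r = x - (polar q x f *s e + polar q x e *s f +
        (polar q x u' *s u + polar q x u *s u'))"
      have r: "polar q r e = 0" "polar q r f = 0" "polar q r u = 0" "polar q r u' = 0"
        using basis by (simp_all add: r_def polar_simps)
      \<comment> \<open>A nonzero remainder would have value 1 and be orthogonal to
        \<open>u\<close>, making \<open>r + u\<close> singular in the complement and hence 0; but
        \<open>r + u\<close> pairs to 1 with \<open>u'\<close>.\<close>
      have "r = 0"
      proof (rule ccontr)
        assume "r \<noteq> 0"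
        then have "q (r + u) = 0"
          using form_1[of r] r basis by (simp add: form_add)
        then have "r + u = 0"
          using form_1[of "r + u"] r u by (auto simp: polar_simps)
        then have "polar q (r + u) u' = 0"
          by (simp add: polar_simps)
        then show False
          using r u' by (simp add: polar_simps)
      qed
      then show "?g ((polar q x f, polar q x e), (polar q x u', polar q x u)) = x"
        by (simp add: r_def)
    qed
    ultimately have "bij ?g"
      by (intro bijI)
    with linear_plane_sum have "isometric scale q (module_prod.scale plane_scale plane_scale)
        (orthogonal_sum hyperbolic_plane (binary_form 1 1))"
      by (rule isometric_by_parametrization)
        (use basis in \<open>auto simp: form_add form_scale polar_simps binary_form_def
          hyperbolic_plane_def orthogonal_sum_def\<close>)
    then show ?thesis ..
  qed
qed

end

section \<open>Finite-dimensional spaces: the effect of the dimension\<close>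

locale finite_quadratic_space =
  quadratic_space scale q + finite_dimensional_vector_space scale Basis
  for scale :: "'a::{field,finite} \<Rightarrow> 'v::ab_group_add \<Rightarrow> 'v" (infixr \<open>*s\<close> 75)
    and q :: "'v \<Rightarrow> 'a" and Basis :: "'v set"
begin

lemma span_neq_UNIV: "finite S \<Longrightarrow> card S < dim UNIV \<Longrightarrow> span S \<noteq> UNIV"
  using dim_le_card[of UNIV S] by auto

text \<open>A triangle needs \<open>w\<close> with prescribed pairing with \<open>v\<close> and
  prescribed value. Adding vectors orthogonal to \<open>v\<close> preserves the pairing, and
  dimension at least 3 leaves enough room to correct the value.\<close>

lemma girth_dim_ge_3:
  assumes "a \<noteq> 0" "q v = a" "dim UNIV \<ge> 3"
  shows "girth (representation_graph q a) = 3"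
proof (cases "(2::'a) = 0")
  case True
  have "v \<noteq> 0"
    using assms form_zero by blast
  then obtain w where w: "polar q v w = a"
    by (rule obtain_polar)
  then have wv: "polar q w v = a"
    using polar_commute by metis
  \<comment> \<open>In characteristic 2 both \<open>v\<close> and \<open>w\<close> are orthogonal to
    themselves and pair to \<open>a\<close>, so they behave like a hyperbolic pair scaled by
    \<open>a\<close>.\<close>
  have proj: "\<exists>y\<in>span {v, w}. \<forall>p\<in>{v, w}. polar q (x - y) p = 0" for x
  proof
    show "(polar q x w / a) *s v + (polar q x v / a) *s w \<in> span {v, w}"
      by (intro span_add span_scale span_base) simp_all
    show "\<forall>p\<in>{v, w}. polar q (x - ((polar q x w / a) *s v + (polar q x v / a) *s w)) p = 0"
      using w wv True assms(1) by (simp add: polar_simps)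
  qed
  have "span {v, w} \<noteq> UNIV"
    using assms(3) card_insert_le_m1[of 2 "{w}" v] by (intro span_neq_UNIV) simp_all
  from obtain_nonsingular_orthogonal[OF proj this]
  obtain z where z: "polar q z v = 0" "polar q z w = 0" "q z \<noteq> 0"
    by auto
  then have comm: "polar q v z = 0" "polar q w z = 0"
    using polar_commute by metis+
  \<comment> \<open>With \<open>z\<close> orthogonal to \<open>w\<close>, adding
    \<open>c *s z\<close> changes the value by c^2 q z; every field element is a square, so the
    missing \<open>a - q w\<close> can be supplied.\<close>
  obtain c where "(a - q w) / q z = c\<^sup>2"
    using square_surj_char_2[OF True] by (rule surjE)
  then have "c\<^sup>2 * q z = a - q w"
    using z(3) by (simp add: field_simps)
  then have "q (w + c *s z) = a" "polar q v (w + c *s z) = a"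
    using w comm by (simp_all add: form_add form_scale polar_simps)
  then show ?thesis
    using assms by (intro girth_eq_3_if_polar)
next
  case False
  have proj1: "\<exists>y\<in>span {v}. \<forall>p\<in>{v}. polar q (x - y) p = 0" for x
  proof
    show "(polar q x v / (2 * a)) *s v \<in> span {v}"
      by (intro span_scale span_base) simp_all
    show "\<forall>p\<in>{v}. polar q (x - (polar q x v / (2 * a)) *s v) p = 0"
      using False assms(1,2) by (simp add: polar_simps)
  qed
  have "span {v} \<noteq> UNIV"
    using assms(3) by (intro span_neq_UNIV) simp_all
  from obtain_nonsingular_orthogonal[OF proj1 this]
  obtain e where e: "polar q e v = 0" "q e \<noteq> 0"
    by auto
  then have ve: "polar q v e = 0"
    using polar_commute by metis
  have proj2: "\<exists>y\<in>span {v, e}. \<forall>p\<in>{v, e}. polar q (x - y) p = 0" for x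
  proof
    show "(polar q x v / (2 * a)) *s v + (polar q x e / (2 * q e)) *s e \<in> span {v, e}"
      by (intro span_add span_scale span_base) simp_all
    show "\<forall>p\<in>{v, e}. polar q
        (x - ((polar q x v / (2 * a)) *s v + (polar q x e / (2 * q e)) *s e)) p = 0"
      using False assms(1,2) e ve by (simp add: polar_simps)
  qed
  have "span {v, e} \<noteq> UNIV"
    using assms(3) card_insert_le_m1[of 2 "{e}" v] by (intro span_neq_UNIV) simp_all
  from obtain_nonsingular_orthogonal[OF proj2 this]
  obtain f where f: "polar q f v = 0" "polar q f e = 0" "q f \<noteq> 0"
    by auto
  then have comm: "polar q v f = 0" "polar q e f = 0"
    using polar_commute by metis+
  define h :: 'a where "h = 1 / 2"
  have h: "2 * h = 1"
    using False by (simp add: h_def)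
  \<comment> \<open>The target is 3a/4, the value to be added to q (v/2) = a/4 to reach
    \<open>a\<close>.\<close>
  obtain s t where st: "q e * s\<^sup>2 + q f * t\<^sup>2 = 3 * a * h\<^sup>2"
    using e(2) f(3) by (rule diagonal_form_universal)
  define z where "z = s *s e + t *s f"
  have z: "q z = 3 * a * h\<^sup>2" "polar q v z = 0"
    using st ve comm by (simp_all add: z_def form_add form_scale polar_simps mult.commute)
  have "q (h *s v + z) = a * (2 * h)\<^sup>2"
    using assms(2) z by (simp add: form_add form_scale polar_simps power_mult_distrib)
  moreover have "polar q v (h *s v + z) = (2 * h) * a"
    using assms(2) z by (simp add: polar_simps)
  ultimately show ?thesis
    using assms(1,2) h by (intro girth_eq_3_if_polar[of a v "h *s v + z"]) simp_all
qed

lemma obtain_scale_dim_1: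
  assumes "dim UNIV = 1" "v \<noteq> 0"
  obtains c where "x = c *s v"
proof -
  have "UNIV \<subseteq> span {v}"
    using assms by (intro card_ge_dim_independent) (auto simp: dependent_single)
  then show ?thesis
    using that by (auto simp: span_singleton)
qed

text \<open>In characteristic 2 a vector is orthogonal to all its multiples, so a line would be its
  own radical.\<close>

lemma char_neq_2_dim_1:
  assumes "dim UNIV = 1" "q v \<noteq> 0"
  shows "(2::'a) \<noteq> 0"
proof
  assume "(2::'a) = 0"
  have "v \<noteq> 0"
    using assms(2) form_zero by auto
  have "polar q v x = 0" for x
  proof -
    obtain c where "x = c *s v"
      using assms(1) \<open>v \<noteq> 0\<close> by (rule obtain_scale_dim_1)
    then show ?thesis
      using \<open>(2::'a) = 0\<close> by (simp add: polar_simps)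
  qed
  then show False
    using eq_zero_if_orthogonal \<open>v \<noteq> 0\<close> by blast
qed

lemma form_eq_iff_dim_1:
  assumes "dim UNIV = 1" "q v \<noteq> 0"
  shows "q x = q v \<longleftrightarrow> x = v \<or> x = - v"
proof
  assume "q x = q v"
  have "v \<noteq> 0"
    using assms(2) form_zero by auto
  with assms(1) obtain c where c: "x = c *s v"
    by (rule obtain_scale_dim_1)
  with \<open>q x = q v\<close> assms(2) have "c\<^sup>2 = 1"
    by (simp add: form_scale)
  then show "x = v \<or> x = - v"
    using c by (auto simp: power2_eq_1_iff)
qed (auto simp: form_minus)

lemma bij_plane_dim_2:
  assumes "dim UNIV = 2" "v \<noteq> 0" "w \<notin> span {v}"
  shows "bij (\<lambda>(x, y). x *s v + y *s w)"
proof (rule bijI)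
  have coeff: "x = 0 \<and> y = 0" if "x *s v + y *s w = 0" for x y
  proof -
    have "y = 0"
    proof (rule ccontr)
      assume "y \<noteq> 0"
      then have "w = (1 / y) *s (y *s w)"
        by simp
      also have "y *s w = (- x) *s v"
        using that by (simp add: eq_neg_iff_add_eq_0 add.commute)
      also have "(1 / y) *s ((- x) *s v) \<in> span {v}"
        by (intro span_scale span_base) simp
      finally show False
        using assms(3) by simp
    qed
    with that assms(2) show ?thesis
      by simp
  qed
  show "inj (\<lambda>(x, y). x *s v + y *s w)"
  proof (rule injI, clarify)
    fix x y x' y' assume "x *s v + y *s w = x' *s v + y' *s w"
    then have "(x - x') *s v + (y - y') *s w = 0"
      by (simp add: algebra_simps)
    then show "x = x' \<and> y = y'"
      using coeff by force
  qed
  have "v \<noteq> w"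
    using assms(3) span_base[of v "{v}"] by auto
  have "independent {w, v}"
    using assms by (intro independent_insertI) (auto simp: dependent_single independent_empty)
  then have "UNIV \<subseteq> span {w, v}"
    using assms(1) \<open>v \<noteq> w\<close> by (intro card_ge_dim_independent) auto
  then have "\<exists>y x. u - y *s w = x *s v" for u
    by (auto simp: span_insert span_singleton)
  then show "surj (\<lambda>(x, y). x *s v + y *s w)"
    unfolding surj_def by (metis case_prod_conv diff_eq_eq)
qed

lemma isometric_plane_dim_2:
  assumes "dim UNIV = 2" "v \<noteq> 0" "w \<notin> span {v}" "polar q v w = 1"
  shows "isometric scale q plane_scale (binary_form (q v) (q w))"
  using assms by (intro isometric_plane bij_plane_dim_2)

text \<open>A hyperbolic pair is independent, as \<open>e\<close> is orthogonal to its multiples but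
  not to \<open>f\<close>; in dimension 2 it is therefore a basis.\<close>

lemma isometric_hyperbolic_plane_dim_2:
  assumes "dim UNIV = 2" "isotropic q"
  shows "isometric scale q plane_scale hyperbolic_plane"
proof -
  obtain e where e: "e \<noteq> 0" "q e = 0"
    using assms(2) by (auto simp: isotropic_def)
  then obtain f where f: "q f = 0" "polar q e f = 1"
    by (rule obtain_hyperbolic_pair)
  have "f \<notin> span {e}"
    using f(2) e(2) by (auto simp: span_singleton polar_simps)
  from isometric_plane_dim_2[OF assms(1) e(1) this f(2)] show ?thesis
    by (simp add: e f hyperbolic_plane_def)
qed

lemma isometric_if_triangle_dim_2:
  assumes "dim UNIV = 2" "a \<noteq> 0" "(3::'a) \<noteq> 0" "q v = a" "q w = a" "q (v - w) = a"
  shows "isometric scale q plane_scale (binary_form a (inverse a))"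
proof -
  have polar: "polar q v w = a"
    using assms by (simp add: form_diff)
  have "v \<noteq> 0"
    using assms form_zero by blast
  have "inverse a *s w \<notin> span {v}"
  proof
    assume "inverse a *s w \<in> span {v}"
    then have "a *s (inverse a *s w) \<in> span {v}"
      by (rule span_scale)
    then obtain c where c: "w = c *s v"
      using assms(2) by (auto simp: span_singleton)
    \<comment> \<open>Comparing values gives c^2 = 1, and comparing the pairing 2ca with
      \<open>a\<close> gives 2c = 1. Now c = 1 is absurd and c = -1 means 3 = 0.\<close>
    then have "c\<^sup>2 = 1" and c2: "c * 2 = 1"
      using polar assms(2,4,5) by (auto simp: form_scale polar_simps)
    then consider "c = 1" | "c = - 1"
      by (auto simp: power2_eq_1_iff)
    then have "(3::'a) = 0"
    proof cases
      case 1
      with c2 have "(1 + 1 :: 'a) = 1 + 0"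
        by simp
      then show ?thesis
        by (simp only: add_left_cancel) simp
    next
      case 2
      have "(3::'a) = 1 + 2"
        by simp
      also have "\<dots> = 0"
        using c2 2 by (simp add: minus_equation_iff)
      finally show ?thesis .
    qed
    with assms(3) show False ..
  qed
  moreover have "polar q v (inverse a *s w) = 1"
    using polar assms(2) by (simp add: polar_simps)
  ultimately have "isometric scale q plane_scale (binary_form (q v) (q (inverse a *s w)))"
    by (rule isometric_plane_dim_2[OF assms(1) \<open>v \<noteq> 0\<close>])
  moreover have "q (inverse a *s w) = inverse a"
    using assms(2,5) by (simp add: form_scale field_simps power2_eq_square)
  ultimately show ?thesis
    using assms(4) by simp
qed

end

section \<open>The two exceptional forms over F_2\<close>

text \<open>Over F_2 the nonzero singular vectors are (1,0) and (0,1), and their difference (1,1)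
  has value 1.\<close>

lemma hyperbolic_plane_no_triangle:
  fixes x y :: "'a::{field,finite} \<times> 'a"
  assumes "CARD('a) = 2" "x \<noteq> 0" "y \<noteq> 0" "x \<noteq> y"
    and "hyperbolic_plane x = 0" "hyperbolic_plane y = 0" "hyperbolic_plane (x - y) = 0"
  shows False
proof -
  have field: "c = 0 \<or> c = 1" for c :: 'a
    using UNIV_eq_0_1_if_CARD_2[OF assms(1)] by blast
  obtain x1 x2 y1 y2 where xy: "x = (x1, x2)" "y = (y1, y2)"
    by (metis surj_pair)
  show ?thesis
    using assms(2-) field[of x1] field[of x2] field[of y1] field[of y2] unfolding xy
    by (auto simp: hyperbolic_plane_def binary_form_def zero_prod_def)
qed

text \<open>Over F_2 the form [1,1] takes the value 1 at every nonzero vector. A nonzero singular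
  vector thus has hyperbolic part (1,0) or (0,1) with zero tail, or (1,1) with nonzero tail, and no
  two distinct such vectors have a sum of this kind.\<close>

lemma orthogonal_sum_no_triangle:
  fixes x y :: "('a::{field,finite} \<times> 'a) \<times> ('a \<times> 'a)"
  defines "Q \<equiv> orthogonal_sum hyperbolic_plane (binary_form 1 1)"
  assumes CARD: "CARD('a) = 2" and "x \<noteq> 0" "y \<noteq> 0" "x \<noteq> y" "Q x = 0" "Q y = 0" "Q (x - y) = 0"
  shows False
proof -
  have field: "c = 0 \<or> c = 1" for c :: 'a
    using UNIV_eq_0_1_if_CARD_2[OF CARD] by blast
  have two: "(2::'a) = 0"
    by (rule two_eq_zero_if_CARD_2[OF CARD])
  have three: "(3::'a) = 1"
  proof -
    have "(3::'a) = 1 + 2"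
      by simp
    then show ?thesis
      using two by simp
  qed
  have neg: "- (1::'a) = 1"
    using two by (metis add_eq_0_iff one_add_one)
  have diff: "z - w = z + w" for z w :: 'a
    using field[of w] neg by (metis add_0_right diff_conv_add_uminus minus_zero)
  obtain x1 x2 x3 x4 y1 y2 y3 y4 where xy: "x = ((x1, x2), (x3, x4))" "y = ((y1, y2), (y3, y4))"
    by (metis surj_pair)
  have sing: "(z1 = 1 \<and> z2 = 0 \<and> z3 = 0 \<and> z4 = 0) \<or> (z1 = 0 \<and> z2 = 1 \<and> z3 = 0 \<and> z4 = 0) \<or>
      (z1 = 1 \<and> z2 = 1 \<and> (z3 \<noteq> 0 \<or> z4 \<noteq> 0))"
    if "Q ((z1, z2), (z3, z4)) = 0" "((z1, z2), (z3, z4)) \<noteq> 0" for z1 z2 z3 z4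
    using that field[of z1] field[of z2] field[of z3] field[of z4] two three
    by (auto simp: Q_def orthogonal_sum_def hyperbolic_plane_def binary_form_def zero_prod_def)
  have "Q ((x1 + y1, x2 + y2), (x3 + y3, x4 + y4)) = 0"
    using assms(8) unfolding xy by (simp add: diff)
  moreover have "((x1 + y1, x2 + y2), (x3 + y3, x4 + y4)) \<noteq> 0"
    using assms(5) unfolding xy by (simp add: zero_prod_def flip: diff)
  ultimately have
    "(x1 + y1 = 1 \<and> x2 + y2 = 0 \<and> x3 + y3 = 0 \<and> x4 + y4 = 0) \<or>
      (x1 + y1 = 0 \<and> x2 + y2 = 1 \<and> x3 + y3 = 0 \<and> x4 + y4 = 0) \<or>
      (x1 + y1 = 1 \<and> x2 + y2 = 1 \<and> (x3 + y3 \<noteq> 0 \<or> x4 + y4 \<noteq> 0))"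
    by (rule sing)
  with sing[OF assms(6,3)[unfolded xy]] sing[OF assms(7,4)[unfolded xy]] assms(5)[unfolded xy] two
  show False
    by (elim disjE conjE) simp_all
qed

section \<open>Transport along isometries, and reflections\<close>

context quadratic_space
begin

lemma no_triangle_if_isometric:
  fixes s' :: "'a \<Rightarrow> 'w::ab_group_add \<Rightarrow> 'w"
  assumes "isometric scale q s' q'"
    and "\<And>x y. x \<noteq> 0 \<Longrightarrow> y \<noteq> 0 \<Longrightarrow> x \<noteq> y \<Longrightarrow> q' x = a \<Longrightarrow> q' y = a \<Longrightarrow> q' (x - y) = a \<Longrightarrow> False"
    and "v \<noteq> 0" "w \<noteq> 0" "v \<noteq> w" "q v = a" "q w = a" "q (v - w) = a"
  shows False
proof -
  obtain f where "Vector_Spaces.linear scale s' f" and f: "bij f" "\<And>x. q' (f x) = q x"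
    using assms(1) by (auto simp: isometric_def)
  then interpret f: Vector_Spaces.linear scale s' f
    by blast
  have "f x = f y \<longleftrightarrow> x = y" for x y
    using f(1) by (simp add: bij_is_inj inj_eq)
  then have "f v \<noteq> f 0" "f w \<noteq> f 0" "f v \<noteq> f w"
    using assms by blast+
  then show False
    using assms(2)[of "f v" "f w"] f(2) assms(6-8) by (metis f.diff f.zero)
qed

lemma girth_eq_3_if_isometric:
  assumes "a \<noteq> 0" "isometric scale q plane_scale (binary_form a (inverse a))"
  shows "girth (representation_graph q a) = 3"
proof -
  obtain f where "Vector_Spaces.linear scale plane_scale f" "bij f"
    and f: "\<And>x. binary_form a (inverse a) (f x) = q x"
    using assms(2) by (auto simp: isometric_def)
  then interpret f: Vector_Spaces.linear scale plane_scale f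
    by blast
  \<comment> \<open>In [a, 1/a] the vectors (1,0) and (0,a) have value \<open>a\<close> and pairing
    \<open>a\<close>.\<close>
  obtain v w where vw: "f v = (1, 0)" "f w = (0, a)"
    using bij_is_surj[OF \<open>bij f\<close>] by (metis surjD)
  have "q v = a" "q w = a" "q (v + w) = 3 * a"
    using assms(1) unfolding f[symmetric] f.add vw
    by (simp_all add: binary_form_def power2_eq_square)
  moreover from this have "polar q v w = a"
    by (simp add: polar_def)
  ultimately show ?thesis
    using assms(1) by (intro girth_eq_3_if_polar)
qed

text \<open>\<open>w\<close> is the reflection of \<open>v\<close> along \<open>u\<close>. It moves
  \<open>v\<close> because the pairing with \<open>u\<close> is nonzero, and w = -v would make 2v a
  nonzero multiple of \<open>u\<close>, putting \<open>u\<close> on the line of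
  \<open>v\<close>.\<close>

lemma obtain_reflection:
  assumes "polar q v u \<noteq> 0" "q u \<noteq> 0" "u \<notin> span {v}"
  obtains w where "q w = q v" "v \<noteq> w" "v \<noteq> - w"
proof
  let ?c = "polar q v u / q u"
  let ?w = "v - ?c *s u"
  have c: "?c \<noteq> 0"
    using assms by simp
  show "q ?w = q v"
    using assms(2) by (simp add: form_diff form_scale polar_simps power2_eq_square)
  show "v \<noteq> ?w"
    using assms(1,2) by (auto simp: polar_simps form_zero)
  show "v \<noteq> - ?w"
  proof
    assume "v = - ?w"
    then have "?c *s u = v + v"
      by (simp add: algebra_simps)
    then have "?c *s u \<in> span {v}"
      by (simp add: span_add span_base)
    then have "inverse ?c *s (?c *s u) \<in> span {v}"
      by (rule span_scale)
    then show False
      using c assms(3) by simp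
  qed
qed

end

section \<open>The girth, case by case\<close>

context finite_quadratic_space
begin

text \<open>A scalar c other than 0 and 1 turns a singular \<open>e\<close> into the triangle 0, e,
  ce. Only F_2 lacks such a scalar; there a triangle amounts to a totally singular plane, and a
  hyperbolic pair always yields a 4-cycle.\<close>

lemma girth_isotropic:
  assumes "isotropic q"
  shows "girth (representation_graph q 0) =
    (if CARD('a) = 2 \<and>
        (isometric scale q plane_scale hyperbolic_plane \<or>
         isometric scale q (module_prod.scale plane_scale plane_scale)
           (orthogonal_sum hyperbolic_plane (binary_form 1 1)))
     then 4 else 3)"
proof (cases "CARD('a) = 2")
  case True
  define iso where "iso \<longleftrightarrow> isometric scale q plane_scale hyperbolic_plane \<or>
    isometric scale q (module_prod.scale plane_scale plane_scale)
      (orthogonal_sum hyperbolic_plane (binary_form 1 1))"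
  show ?thesis
  proof (cases iso)
    case iso: True
    have no_triangle: False if "v \<noteq> 0" "w \<noteq> 0" "v \<noteq> w" "q v = 0" "q w = 0" "q (v - w) = 0" for v w
      using iso unfolding iso_def
    proof
      assume "isometric scale q plane_scale hyperbolic_plane"
      from no_triangle_if_isometric[OF this _ that] show False
        using hyperbolic_plane_no_triangle[OF True] by blast
    next
      assume "isometric scale q (module_prod.scale plane_scale plane_scale)
        (orthogonal_sum hyperbolic_plane (binary_form 1 1))"
      from no_triangle_if_isometric[OF this _ that] show False
        using orthogonal_sum_no_triangle[OF True] by blast
    qed
    obtain e where e: "e \<noteq> 0" "q e = 0"
      using assms by (auto simp: isotropic_def)
    then obtain f where f: "q f = 0" "polar q e f = 1"
      by (rule obtain_hyperbolic_pair)
    have "f \<noteq> 0" "e \<noteq> f" "e \<noteq> - f"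
      using f by (auto simp: polar_simps)
    then have "girth (representation_graph q 0) = 4"
      using e f no_triangle by (intro girth_eq_4_if_square[of e f])
    then show ?thesis
      using True iso unfolding iso_def by simp
  next
    case False
    have "c = 0 \<or> c = 1" for c :: 'a
      using UNIV_eq_0_1_if_CARD_2[OF True] by blast
    then obtain v w where "v \<noteq> 0" "w \<noteq> 0" "v \<noteq> w" "q v = 0" "q w = 0" "q (v - w) = 0"
      using isometric_if_no_isotropic_plane[OF _ two_eq_zero_if_CARD_2[OF True] assms] False
      unfolding iso_def by blast
    then have "girth (representation_graph q 0) = 3"
      by (rule girth_eq_3_if_triangle)
    then show ?thesis
      using False unfolding iso_def by simp
  qed
next
  case False
  have "UNIV \<noteq> {0, 1::'a}"
    using False by (metis card_2_iff zero_neq_one)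
  then obtain c :: 'a where c: "c \<noteq> 0" "c \<noteq> 1"
    by blast
  obtain e where e: "e \<noteq> 0" "q e = 0"
    using assms by (auto simp: isotropic_def)
  have "e \<noteq> c *s e"
    using c e by (metis scale_one scale_right_imp_eq)
  then have "girth (representation_graph q 0) = 3"
    using c e by (intro girth_eq_3_if_triangle[of e "c *s e"])
      (simp_all add: form_diff form_scale polar_simps)
  then show ?thesis
    using False by simp
qed

lemma girth_dim_2_eq_4:
  assumes "dim UNIV = 2" "a \<noteq> 0" "q v = a"
    and not_hyperbolic: "\<not> (CARD('a) = 2 \<and> isometric scale q plane_scale hyperbolic_plane)"
    and char: "CHAR('a) \<noteq> 3"
    and not_iso: "\<not> isometric scale q plane_scale (binary_form a (inverse a))"
  shows "girth (representation_graph q a) = 4"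
proof -
  have "(3::'a) \<noteq> 0"
  proof
    assume "(3::'a) = 0"
    then have "CHAR('a) dvd 3"
      using of_nat_eq_0_iff_char_dvd[where ?'a = 'a, of 3] by simp
    then show False
      using char prime_nat_iff[of 3] CHAR_not_1[where ?'a = 'a] by (auto simp: prime_nat_numeral_eq)
  qed
  then have no_triangle: False if "q v = a" "q w = a" "q (v - w) = a" for v w
    using isometric_if_triangle_dim_2[OF assms(1,2) _ that] not_iso by blast
  have "v \<noteq> 0"
    using assms(2,3) form_zero by blast
  obtain v w where vw: "q v = a" "q w = a" "v \<noteq> w" "v \<noteq> - w"
  proof (cases "isotropic q")
    case True
    then have "CARD('a) \<noteq> 2"
      using isometric_hyperbolic_plane_dim_2[OF assms(1)] not_hyperbolic by blast
    \<comment> \<open>Only F_2 and F_3 consist of 0, 1 and -1, and both are excluded here.\<close>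
    have "UNIV \<noteq> {0, 1, - 1::'a}"
    proof
      assume UNIV: "UNIV = {0, 1, - 1::'a}"
      then have "CARD('a) \<le> 3"
        by (metis card.empty card_insert_le_m1 diff_Suc_1 numeral_3_eq_3 order_refl zero_less_Suc)
      moreover have "card {0, 1::'a} \<le> CARD('a)"
        by (rule card_mono) simp_all
      ultimately have "CARD('a) = 3"
        using \<open>CARD('a) \<noteq> 2\<close> by simp
      then show False
        using char CHAR_eq_if_CARD_eq_prime_power[where ?'a = 'a, of 3 1] by simp
    qed
    then obtain t :: 'a where t: "t \<noteq> 0" "t \<noteq> 1" "t \<noteq> - 1"
      by blast
    obtain e where e: "e \<noteq> 0" "q e = 0"
      using True by (auto simp: isotropic_def)
    then obtain f where f: "q f = 0" "polar q e f = 1"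
      by (rule obtain_hyperbolic_pair)
    then have fe: "polar q f e = 1"
      using polar_commute by metis
    \<comment> \<open>On a hyperbolic pair the value is the product of the coordinates, so (1, a)
      and (t, a/t) both have value \<open>a\<close>. Pairing with \<open>f\<close> reads off the
      first coordinate and tells them apart up to sign.\<close>
    let ?v = "e + a *s f" and ?w = "t *s e + (a / t) *s f"
    have "q ?v = a" "q ?w = a"
      using e f t by (simp_all add: form_add form_scale polar_simps)
    moreover have "polar q f ?v = 1" "polar q f ?w = t" "polar q f (- ?w) = - t"
      using e f fe by (simp_all add: polar_simps)
    then have "?v \<noteq> ?w" "?v \<noteq> - ?w"
      using t by (metis, metis minus_minus)
    ultimately show thesis
      by (rule that)
  next
    case False
    \<comment> \<open>The reflecting vector must be off the line of \<open>v\<close> and not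
      orthogonal to \<open>v\<close>. In characteristic 2 the second condition implies the first;
      otherwise, if \<open>u\<close> is orthogonal to \<open>v\<close>, then \<open>u + v\<close>
      pairs to 2a.\<close>
    have "\<exists>u. polar q v u \<noteq> 0 \<and> u \<notin> span {v}"
    proof (cases "(2::'a) = 0")
      case True
      obtain u where "polar q v u = 1"
        using \<open>v \<noteq> 0\<close> by (rule obtain_polar)
      moreover have "u \<notin> span {v}"
        using True calculation by (auto simp: span_singleton polar_simps)
      ultimately show ?thesis
        by (metis zero_neq_one)
    next
      case False
      have "span {v} \<noteq> UNIV"
        using assms(1) by (intro span_neq_UNIV) simp_all
      then obtain u where u: "u \<notin> span {v}"
        by blast
      then have "u + v \<notin> span {v}"
        using span_diff[of "u + v" "{v}" v] by (auto simp: span_base)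
      moreover have "polar q v u \<noteq> 0 \<or> polar q v (u + v) \<noteq> 0"
        using False assms(2,3) by (auto simp: polar_simps)
      ultimately show ?thesis
        using u by blast
    qed
    then obtain u where u: "polar q v u \<noteq> 0" "u \<notin> span {v}"
      by blast
    moreover have "q u \<noteq> 0"
      using False u(1) polar_zero_right unfolding isotropic_def by metis
    ultimately obtain w where "q w = q v" "v \<noteq> w" "v \<noteq> - w"
      using obtain_reflection by metis
    then show thesis
      using that assms(3) by metis
  qed
  moreover from vw have "v \<noteq> 0" "w \<noteq> 0"
    using assms(2) form_zero by blast+
  ultimately show ?thesis
    using no_triangle by (intro girth_eq_4_if_square[of v w])
qed

text \<open>Over F_2 the product xy is nonzero only at (1,1).\<close>

lemma girth_hyperbolic_plane_CARD_2:
  assumes CARD: "CARD('a) = 2" and "a \<noteq> 0" "isometric scale q plane_scale hyperbolic_plane"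
  shows "girth (representation_graph q a) = \<infinity>"
proof (rule girth_infinite_if_unique)
  obtain f where f: "bij f" "\<And>x. hyperbolic_plane (f x) = q x"
    using assms(3) by (auto simp: isometric_def)
  have field: "c = 0 \<or> c = 1" for c :: 'a
    using UNIV_eq_0_1_if_CARD_2[OF CARD] by blast
  have "f x = (1, 1)" if "q x = a" for x
  proof -
    obtain y z where yz: "f x = (y, z)"
      by (cases "f x")
    then have "y * z \<noteq> 0"
      using f(2)[of x] that assms(2) by (simp add: hyperbolic_plane_def binary_form_def)
    then show ?thesis
      using yz field[of y] field[of z] by auto
  qed
  then show "x = y" if "q x = a" "q y = a" for x y
    using that f(1) by (metis bij_is_inj injD)
qed

text \<open>The neighbours of x are x + v and x - v. A cycle cannot turn back, so it keeps adding
  the same vector and closes only after a multiple of the characteristic.\<close>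

lemma girth_dim_1:
  assumes "dim UNIV = 1" "a \<noteq> 0" "q v = a"
  shows "girth (representation_graph q a) = enat CHAR('a)"
proof -
  let ?p = "CHAR('a)"
  have two: "(2::'a) \<noteq> 0"
    using char_neq_2_dim_1 assms by blast
  have adj: "representation_graph q a x y \<longleftrightarrow> x - y = v \<or> x - y = - v" for x y
    using form_eq_iff_dim_1[OF assms(1), of v "x - y"] assms(2,3) form_zero
    by (auto simp: representation_graph_def)
  have v: "v \<noteq> 0"
    using assms(2,3) form_zero by blast
  have "prime ?p"
    by (rule prime_CHAR_semidom) (simp add: finite_imp_CHAR_pos)
  moreover have "?p \<noteq> 2"
    using two of_nat_CHAR[where ?'a = 'a] by (metis of_nat_numeral)
  ultimately have p: "?p \<ge> 3"
    using prime_ge_2_nat[of ?p] by linarith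
  \<comment> \<open>This lets the closing edge, from index p - 1 back to 0, be treated like all
    others.\<close>
  have of_nat_mod: "of_nat (n mod ?p) = (of_nat n :: 'a)" for n
  proof -
    have "(of_nat n :: 'a) = of_nat (n div ?p * ?p + n mod ?p)"
      by simp
    also have "\<dots> = of_nat (n mod ?p)"
      unfolding of_nat_add of_nat_mult by simp
    finally show ?thesis ..
  qed
  have inj: "i = j" if "i \<le> j" "j < ?p" "of_nat i = (of_nat j :: 'a)" for i j
  proof -
    have "of_nat (j - i) = (0::'a)"
      using that by (simp add: of_nat_diff)
    then have "?p dvd j - i"
      by (simp add: of_nat_eq_0_iff_char_dvd)
    with that show ?thesis
      by (metis diff_is_0_eq dual_order.antisym dvd_imp_le less_imp_diff_less linorder_not_less
          not_gr_zero)
  qed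
  define vs where "vs = map (\<lambda>i. of_nat i *s v) [0..<?p]"
  have "is_cycle (representation_graph q a) vs"
    unfolding is_cycle_def
  proof (intro conjI allI impI)
    show "length vs \<ge> 3"
      using p by (simp add: vs_def)
    have "inj_on (\<lambda>i. of_nat i *s v) {0..<?p}"
      using v inj by (auto simp: inj_on_def) (metis linear)
    then show "distinct vs"
      by (simp add: vs_def distinct_map)
    fix i assume "i < length vs"
    then have i: "i < ?p"
      by (simp add: vs_def)
    have "vs ! (Suc i mod length vs) = of_nat (Suc i mod ?p) *s v"
      using p by (simp add: vs_def)
    then have "vs ! i - vs ! (Suc i mod length vs) = - v"
      using i unfolding of_nat_mod by (simp add: vs_def scale_left_distrib)
    then show "representation_graph q a (vs ! i) (vs ! (Suc i mod length vs))"
      by (simp add: adj)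
  qed
  then have "girth (representation_graph q a) \<le> enat (length vs)"
    unfolding girth_def by (intro INF_lower) simp
  moreover have "enat ?p \<le> girth (representation_graph q a)"
    unfolding girth_def
  proof (rule INF_greatest)
    fix vs assume "vs \<in> {vs. is_cycle (representation_graph q a) vs}"
    then have len: "length vs \<ge> 3" and "distinct vs"
      and step: "\<And>i. i < length vs \<Longrightarrow> representation_graph q a (vs ! i) (vs ! (Suc i mod length vs))"
      by (auto simp: is_cycle_def)
    let ?n = "length vs"
    define d where "d = (\<lambda>i. vs ! i - vs ! (Suc i mod ?n))"
    have d_cases: "d i = v \<or> d i = - v" if "i < ?n" for i
      using step[OF that] by (simp add: adj d_def)
    have d_const: "d i = d 0" if "i < ?n" for i
      using that
    proof (induction i)
      case (Suc i)
      \<comment> \<open>Opposite consecutive steps would return to vertex \<open>i\<close> after two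
        edges, impossible in a cycle of length at least 3.\<close>
      have "d (Suc i) \<noteq> - d i"
      proof
        assume "d (Suc i) = - d i"
        then have "vs ! i = vs ! (Suc (Suc i) mod ?n)"
          using Suc.prems by (simp add: d_def)
        then have "i = Suc (Suc i) mod ?n"
          using \<open>distinct vs\<close> Suc.prems
          by (subst (asm) nth_eq_iff_index_eq) (auto intro: mod_less_divisor)
        then show False
          using Suc.prems len by (cases "Suc (Suc i) = ?n") auto
      qed
      then have "d (Suc i) = d i"
        using d_cases[of i] d_cases[of "Suc i"] Suc.prems by auto
      with Suc show ?case
        by simp
    qed simp
    have vs_nth: "vs ! i = vs ! 0 - of_nat i *s d 0" if "i < ?n" for i
      using that
    proof (induction i)
      case (Suc i)
      then have "vs ! Suc i = vs ! i - d i"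
        by (simp add: d_def)
      then show ?case
        using Suc d_const[of i] by (simp add: scale_left_distrib)
    qed simp
    obtain k where k: "?n = Suc k"
      using len by (cases ?n) auto
    \<comment> \<open>The closing edge makes the n equal steps add up to 0, so the characteristic
      divides n.\<close>
    have "vs ! k - vs ! 0 = d 0"
      using d_const[of k] k by (simp add: d_def)
    then have "- (of_nat k *s d 0) = d 0"
      using vs_nth[of k] k by simp
    then have "of_nat k *s d 0 + d 0 = 0"
      by (simp only: neg_eq_iff_add_eq_0)
    then have "of_nat ?n *s d 0 = 0"
      using k by (simp add: scale_left_distrib add.commute)
    moreover have "d 0 \<noteq> 0"
      using d_cases[of 0] v k by (metis neg_0_equal_iff_equal zero_less_Suc)
    ultimately have "of_nat ?n = (0::'a)"
      using scale_eq_0_iff by blast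
    then have "?p dvd ?n"
      by (simp only: of_nat_eq_0_iff_char_dvd)
    then show "enat ?p \<le> enat ?n"
      using len by (auto intro: dvd_imp_le)
  qed
  ultimately show ?thesis
    by (simp add: vs_def)
qed

end

text \<open>The clause on characteristic 3 in dimension 2 is not confined to F_3: in every such
  field q (2v) = 4a = a, so 0, v, -v is a triangle. The value 4 is therefore claimed only outside
  characteristic 3.\<close>

theorem theorem4p2:
  fixes scale :: "'a::{field,finite} \<Rightarrow> 'v::ab_group_add \<Rightarrow> 'v"
    and Basis :: "'v set"
    and q :: "'v \<Rightarrow> 'a"
    and a :: 'a
    and p m :: nat
  assumes "prime p" and "m \<ge> 1" and "CARD('a) = p ^ m"
    and "finite_dimensional_vector_space scale Basis"
    and "quadratic_form scale q"
    and "nondegenerate q"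
    and "a \<in> represented0 q"
  shows
    "(a = 0 \<longrightarrow>
        girth (representation_graph q a) =
          (if CARD('a) = 2 \<and>
              (isometric scale q plane_scale hyperbolic_plane \<or>
               isometric scale q (module_prod.scale plane_scale plane_scale)
                 (orthogonal_sum hyperbolic_plane (binary_form 1 1)))
           then 4 else 3)) \<and>
     (a \<noteq> 0 \<and> vector_space.dim scale UNIV = 1 \<longrightarrow>
        CHAR('a) \<noteq> 2 \<and> girth (representation_graph q a) = enat p) \<and>
     (a \<noteq> 0 \<and> vector_space.dim scale UNIV = 2 \<longrightarrow>
        (CARD('a) = 2 \<and> isometric scale q plane_scale hyperbolic_plane \<longrightarrow>
           girth (representation_graph q a) = \<infinity>) \<and>
        (CHAR('a) = 3 \<longrightarrow>
           girth (representation_graph q a) = 3) \<and>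
        (isometric scale q plane_scale (binary_form a (inverse a)) \<longrightarrow>
           girth (representation_graph q a) = 3) \<and>
        (\<not> (CARD('a) = 2 \<and> isometric scale q plane_scale hyperbolic_plane) \<and>
         CHAR('a) \<noteq> 3 \<and>
         \<not> isometric scale q plane_scale (binary_form a (inverse a)) \<longrightarrow>
           girth (representation_graph q a) = 4)) \<and>
     (a \<noteq> 0 \<and> vector_space.dim scale UNIV \<ge> 3 \<longrightarrow>
        girth (representation_graph q a) = 3)"
proof -
  interpret finite_dimensional_vector_space scale Basis
    by fact
  interpret finite_quadratic_space scale q Basis
    by unfold_locales fact+
  show ?thesis
  proof (cases "a = 0")
    case True
    \<comment> \<open>\<open>represented\<close> never contains 0, so 0 can only enter
      \<open>represented0\<close> through isotropy.\<close>
    then have "isotropic q"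
      using assms(7) by (auto simp: represented0_def represented_def split: if_splits)
    with True show ?thesis
      by (simp add: girth_isotropic)
  next
    case False
    then obtain v where v: "q v = a"
      using assms(7) by (auto simp: represented0_def represented_def split: if_splits)
    have CHAR: "CHAR('a) = p"
      using assms(1,3) by (rule CHAR_eq_if_CARD_eq_prime_power)
    have "CHAR('a) \<noteq> 2" if "dim UNIV = 1"
      using char_neq_2_dim_1[OF that] False v of_nat_CHAR[where ?'a = 'a]
      by (metis of_nat_numeral)
    moreover have "girth (representation_graph q a) = 3" if "CHAR('a) = 3"
    proof -
      have three: "(3::'a) = 0"
        using that of_nat_CHAR[where ?'a = 'a] by simp
      have "polar q v (- v) = a - 3 * a"
        by (simp add: polar_simps v)
      with three show ?thesis
        using False v by (intro girth_eq_3_if_polar[of a v "- v"]) (simp_all add: form_minus)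
    qed
    moreover have "girth (representation_graph q a) = enat p" if "dim UNIV = 1"
      using girth_dim_1[OF that False v] CHAR by simp
    ultimately show ?thesis
      using False girth_dim_ge_3[OF False v] girth_hyperbolic_plane_CARD_2[OF _ False]
        girth_eq_3_if_isometric[OF False] girth_dim_2_eq_4[OF _ False v]
      by presburger
  qed
qed

end
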